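(* Let $n\geq 1$, let $I_n=\{0,\ldots,n-1\}$ and let $\mathrm{ND}_n=\{0^k1^{n-k}:0\leq k\leq n\}\subseteq\{0,1\}^n$ be the set of non-decreasing binary sequences of length $n$. The only simplicial complex over $I_n$ generating $\mathrm{ND}_n$ is the full complex $\Delta_{I_n}$, consisting of all subsets of $I_n$.
   Context: All sets are finite (possibly empty). For $f:B^J\to A^I$ write $f_i(x)=f(x)_i$. For $i\in I$, the input window $\mathcal{W}_f(i)$ is the smallest set $W\subseteq J$ (it exists) such that for all $x,y\in B^J$, $x|_W=y|_W$ implies $f_i(x)=f_i(y)$. A simplicial complex (or complex) over $I$ is a collection of subsets of $I$ (its simplices) closed under taking subsets; the empty set is a simplex of every complex. The communication complex $K_f$ of $f$ is the complex over $I$ in which a non-empty $S\subseteq I$ is a simplex iff $\bigcap_{i\in S}\mathcal{W}_f(i)\neq\emptyset$. A complex $K$ over $I$ generates a language $L\subseteq A^I$ if there exist finite sets $B,J$ and a function $f:B^J\to A^I$ with image exactly $L$ and $K_f\subseteq K$. We write $\{0,1\}^n$ for $\{0,1\}^{I_n}$. *)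

theory Defs
  imports "HOL-Library.FuncSet"
begin

text \<open>The power \<open>B\<^sup>J\<close> of a set \<open>B\<close> is rendered as the set \<open>J \<rightarrow>\<^sub>E B\<close> of extensional
  functions, so the coordinate \<open>f\<^sub>i(x)\<close> is \<open>f x i\<close>. The values of \<open>f\<close> outside
  \<open>J \<rightarrow>\<^sub>E B\<close> never matter.\<close>

definition determines :: "'j set \<Rightarrow> 'b set \<Rightarrow> (('j \<Rightarrow> 'b) \<Rightarrow> 'i \<Rightarrow> 'a) \<Rightarrow> 'i \<Rightarrow> 'j set \<Rightarrow> bool" where
  "determines J B f i W \<longleftrightarrow>
     (\<forall>x\<in>J \<rightarrow>\<^sub>E B. \<forall>y\<in>J \<rightarrow>\<^sub>E B. restrict x W = restrict y W \<longrightarrow> f x i = f y i)"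

text \<open>The least element is taken with respect to inclusion.\<close>

definition input_window :: "'j set \<Rightarrow> 'b set \<Rightarrow> (('j \<Rightarrow> 'b) \<Rightarrow> 'i \<Rightarrow> 'a) \<Rightarrow> 'i \<Rightarrow> 'j set" where
  "input_window J B f i = (LEAST W. W \<subseteq> J \<and> determines J B f i W)"

definition complex_over :: "'i set \<Rightarrow> 'i set set \<Rightarrow> bool" where
  "complex_over I K \<longleftrightarrow> K \<subseteq> Pow I \<and> {} \<in> K \<and> (\<forall>S\<in>K. \<forall>T. T \<subseteq> S \<longrightarrow> T \<in> K)"

definition communication_complex ::
  "'j set \<Rightarrow> 'b set \<Rightarrow> 'i set \<Rightarrow> (('j \<Rightarrow> 'b) \<Rightarrow> 'i \<Rightarrow> 'a) \<Rightarrow> 'i set set" where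
  "communication_complex J B I f =
     {S. S \<subseteq> I \<and> (S = {} \<or> (\<Inter>i\<in>S. input_window J B f i) \<noteq> {})}"

definition generates_via ::
  "'j set \<Rightarrow> 'b set \<Rightarrow> (('j \<Rightarrow> 'b) \<Rightarrow> 'i \<Rightarrow> 'a) \<Rightarrow> 'i set \<Rightarrow> 'a set \<Rightarrow> 'i set set \<Rightarrow> ('i \<Rightarrow> 'a) set \<Rightarrow> bool" where
  "generates_via J B f I A K L \<longleftrightarrow>
     finite J \<and> finite B \<and> f \<in> (J \<rightarrow>\<^sub>E B) \<rightarrow> (I \<rightarrow>\<^sub>E A) \<and>
     f ` (J \<rightarrow>\<^sub>E B) = L \<and> communication_complex J B I f \<subseteq> K"

text \<open>HOL cannot quantify existentially over types, so \<open>J\<close> and \<open>B\<close> range over finite sets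
  of natural numbers. Lemma \<open>generates_viaI\<close> below shows that this is no restriction.\<close>

definition generates :: "'i set \<Rightarrow> 'a set \<Rightarrow> 'i set set \<Rightarrow> ('i \<Rightarrow> 'a) set \<Rightarrow> bool" where
  "generates I A K L \<longleftrightarrow> (\<exists>(J :: nat set) (B :: nat set) f. generates_via J B f I A K L)"

definition nondecreasing :: "nat \<Rightarrow> (nat \<Rightarrow> nat) set" where
  "nondecreasing n = {\<lambda>i\<in>{..<n}. if i < k then 0 else 1 | k. k \<le> n}"

lemma determinesD:
  assumes "determines J B f i W" "x \<in> J \<rightarrow>\<^sub>E B" "y \<in> J \<rightarrow>\<^sub>E B" "restrict x W = restrict y W"
  shows "f x i = f y i"
  using assms(1)[unfolded determines_def, THEN bspec, OF assms(2), THEN bspec, OF assms(3), THEN mp, OF assms(4)] .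

lemma determines_Int:
  assumes "W \<subseteq> J" "determines J B f i V" "determines J B f i W"
  shows "determines J B f i (V \<inter> W)"
  unfolding determines_def
proof (intro ballI impI)
  fix x y assume x: "x \<in> J \<rightarrow>\<^sub>E B" and y: "y \<in> J \<rightarrow>\<^sub>E B"
    and eq: "restrict x (V \<inter> W) = restrict y (V \<inter> W)"
  define z where "z = (\<lambda>j. if j \<in> V then x j else y j)"
  have z: "z \<in> J \<rightarrow>\<^sub>E B"
    using x y by (auto simp: z_def PiE_iff extensional_def)
  have "restrict x V = restrict z V"
    by (auto simp: z_def restrict_def fun_eq_iff)
  then have "f x i = f z i" by (rule determinesD[OF assms(2) x z])
  have "restrict z W = restrict y W"
  proof
    fix j show "restrict z W j = restrict y W j"
      using fun_cong[OF eq, of j] by (auto simp: z_def restrict_def split: if_splits)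
  qed
  then have "f z i = f y i" by (rule determinesD[OF assms(3) z y])
  with \<open>f x i = f z i\<close> show "f x i = f y i" by (rule trans)
qed

lemma ex_input_window:
  assumes "finite J"
  shows "\<exists>W. (W \<subseteq> J \<and> determines J B f i W) \<and> (\<forall>V. V \<subseteq> J \<and> determines J B f i V \<longrightarrow> W \<subseteq> V)"
proof -
  let ?P = "\<lambda>W. W \<subseteq> J \<and> determines J B f i W"
  have "?P J"
    by (auto simp: determines_def PiE_restrict)
  then have "J \<in> Collect ?P" by simp
  moreover have "finite (Collect ?P)"
    using assms by (auto intro: finite_subset[of _ "Pow J"])
  ultimately obtain W where "W \<in> Collect ?P" and m: "\<forall>V\<in>Collect ?P. V \<subseteq> W \<longrightarrow> W = V"
    using finite_has_minimal[of "Collect ?P"] by auto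
  then have W: "?P W" by simp
  have min: "V = W" if "?P V" "V \<subseteq> W" for V
    using m that by blast
  have "W \<subseteq> V" if "?P V" for V
  proof -
    have "?P (W \<inter> V)"
      using determines_Int[of V J B f i W] W that by auto
    then have "W \<inter> V = W" by (rule min) simp
    then show ?thesis by blast
  qed
  with W show ?thesis by blast
qed

lemma input_window_eqI:
  assumes "W \<subseteq> J" "determines J B f i W"
    and "\<And>V. V \<subseteq> J \<Longrightarrow> determines J B f i V \<Longrightarrow> W \<subseteq> V"
  shows "input_window J B f i = W"
  unfolding input_window_def
proof (rule Least_equality)
  show "W \<subseteq> J \<and> determines J B f i W" by (rule conjI[OF assms(1,2)])
  show "W \<subseteq> V" if "V \<subseteq> J \<and> determines J B f i V" for V
    using that by (elim conjE) (rule assms(3))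
qed

lemma input_window:
  assumes "finite J"
  shows "input_window J B f i \<subseteq> J" "determines J B f i (input_window J B f i)"
    and "\<And>V. V \<subseteq> J \<Longrightarrow> determines J B f i V \<Longrightarrow> input_window J B f i \<subseteq> V"
proof -
  from ex_input_window[OF assms, of B f i] obtain W where
    W: "W \<subseteq> J" "determines J B f i W"
    and "\<forall>V. V \<subseteq> J \<and> determines J B f i V \<longrightarrow> W \<subseteq> V"
    by (elim exE conjE)
  then have least: "W \<subseteq> V" if "V \<subseteq> J" "determines J B f i V" for V
    using that by simp
  have eq: "input_window J B f i = W" by (rule input_window_eqI[OF W least])
  show "input_window J B f i \<subseteq> J" "determines J B f i (input_window J B f i)"
    unfolding eq by (rule W)+
  show "input_window J B f i \<subseteq> V" if "V \<subseteq> J" "determines J B f i V" for V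
    unfolding eq by (rule least[OF that])
qed

lemma generates_viaI:
  fixes J :: "'j set" and B :: "'b set" and f :: "('j \<Rightarrow> 'b) \<Rightarrow> 'i \<Rightarrow> 'a"
  assumes "generates_via J B f I A K L"
  shows "generates I A K L"
proof -
  have fin: "finite J" "finite B" and fA: "f \<in> (J \<rightarrow>\<^sub>E B) \<rightarrow> (I \<rightarrow>\<^sub>E A)"
    and im: "f ` (J \<rightarrow>\<^sub>E B) = L" and sub: "communication_complex J B I f \<subseteq> K"
    using assms by (auto simp: generates_via_def)
  obtain g :: "'j \<Rightarrow> nat" where g: "inj_on g J"
    using finite_imp_inj_to_nat_seg[OF fin(1)] by blast
  obtain h :: "'b \<Rightarrow> nat" where h: "inj_on h B"
    using finite_imp_inj_to_nat_seg[OF fin(2)] by blast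
  define J' where "J' = g ` J"
  define B' where "B' = h ` B"
  define down where "down = (\<lambda>x'. \<lambda>j\<in>J. inv_into B h (x' (g j)))"
  define up where "up = (\<lambda>x. \<lambda>j'\<in>J'. h (x (inv_into J g j')))"
  define f' where "f' = (\<lambda>x'. f (down x'))"
  have down: "down x' \<in> J \<rightarrow>\<^sub>E B" if "x' \<in> J' \<rightarrow>\<^sub>E B'" for x'
    using that by (auto simp: down_def J'_def B'_def intro!: inv_into_into)
  have up: "up x \<in> J' \<rightarrow>\<^sub>E B'" if "x \<in> J \<rightarrow>\<^sub>E B" for x
    using that g by (auto simp: up_def J'_def B'_def)
  have down_up: "down (up x) = x" if "x \<in> J \<rightarrow>\<^sub>E B" for x
  proof
    fix j show "down (up x) j = x j"
      using that g h by (cases "j \<in> J") (auto simp: up_def down_def J'_def PiE_iff extensional_def)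
  qed
  have down_agree: "restrict (down x') V = restrict (down y') V"
    if "V \<subseteq> J" "restrict x' (g ` V) = restrict y' (g ` V)" for x' y' V
  proof
    fix j show "restrict (down x') V j = restrict (down y') V j"
      using fun_cong[OF that(2), of "g j"] that(1) by (auto simp: down_def)
  qed
  have up_agree: "restrict (up x) (g ` V) = restrict (up y) (g ` V)"
    if "V \<subseteq> J" "restrict x V = restrict y V" for x y V
  proof
    fix j' show "restrict (up x) (g ` V) j' = restrict (up y) (g ` V) j'"
    proof (cases "j' \<in> g ` V")
      case True
      then obtain j where j: "j \<in> V" "j' = g j" by blast
      then have "x j = y j" using fun_cong[OF that(2), of j] by simp
      moreover have "inv_into J g (g j) = j"
        using j that(1) g by (intro inv_into_f_f) auto
      ultimately show ?thesis using j that(1) by (simp add: up_def)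
    qed simp
  qed
  have det: "determines J' B' f' i (g ` V) \<longleftrightarrow> determines J B f i V" if "V \<subseteq> J" for V i
  proof
    assume d: "determines J' B' f' i (g ` V)"
    show "determines J B f i V"
      unfolding determines_def
    proof (intro ballI impI)
      fix x y assume xy: "x \<in> J \<rightarrow>\<^sub>E B" "y \<in> J \<rightarrow>\<^sub>E B" "restrict x V = restrict y V"
      then have "f' (up x) i = f' (up y) i"
        by (intro determinesD[OF d] up up_agree[OF that])
      with xy show "f x i = f y i" by (simp add: f'_def down_up)
    qed
  next
    assume d: "determines J B f i V"
    show "determines J' B' f' i (g ` V)"
      unfolding determines_def
    proof (intro ballI impI)
      fix x y assume xy: "x \<in> J' \<rightarrow>\<^sub>E B'" "y \<in> J' \<rightarrow>\<^sub>E B'"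
        "restrict x (g ` V) = restrict y (g ` V)"
      then show "f' x i = f' y i"
        unfolding f'_def by (intro determinesD[OF d] down down_agree[OF that])
    qed
  qed
  have win: "input_window J' B' f' i = g ` input_window J B f i" for i
  proof (rule input_window_eqI)
    show "g ` input_window J B f i \<subseteq> J'"
      using input_window(1)[OF fin(1), of B f i] by (auto simp: J'_def)
    show "determines J' B' f' i (g ` input_window J B f i)"
      using det[OF input_window(1)[OF fin(1)]] input_window(2)[OF fin(1)] by (rule iffD2)
    fix V' assume "V' \<subseteq> J'" and d: "determines J' B' f' i V'"
    then obtain V where V: "V \<subseteq> J" "V' = g ` V" by (auto simp: J'_def subset_image_iff)
    with d det[OF V(1)] have "determines J B f i V" by simp
    then have "input_window J B f i \<subseteq> V" by (rule input_window(3)[OF fin(1) V(1)])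
    with V show "g ` input_window J B f i \<subseteq> V'" by blast
  qed
  have "(\<Inter>i\<in>S. input_window J' B' f' i) = {}" if "S \<noteq> {}" "(\<Inter>i\<in>S. input_window J B f i) = {}" for S
  proof (rule ccontr)
    assume "\<not> ?thesis"
    then obtain j' where j': "\<And>i. i \<in> S \<Longrightarrow> j' \<in> g ` input_window J B f i" by (auto simp: win)
    have "inv_into J g j' \<in> input_window J B f i" if "i \<in> S" for i
      using j'[OF that] input_window(1)[OF fin(1), of B f i] g by auto
    with that show False by blast
  qed
  then have "communication_complex J' B' I f' \<subseteq> communication_complex J B I f"
    unfolding communication_complex_def by blast
  moreover have "f' ` (J' \<rightarrow>\<^sub>E B') = f ` (J \<rightarrow>\<^sub>E B)"
  proof
    show "f' ` (J' \<rightarrow>\<^sub>E B') \<subseteq> f ` (J \<rightarrow>\<^sub>E B)" using down by (auto simp: f'_def)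
    show "f ` (J \<rightarrow>\<^sub>E B) \<subseteq> f' ` (J' \<rightarrow>\<^sub>E B')"
    proof
      fix l assume "l \<in> f ` (J \<rightarrow>\<^sub>E B)"
      then obtain x where x: "x \<in> J \<rightarrow>\<^sub>E B" "l = f x" by blast
      then have "l = f' (up x)" by (simp add: f'_def down_up)
      with up[OF x(1)] show "l \<in> f' ` (J' \<rightarrow>\<^sub>E B')" by blast
    qed
  qed
  moreover have "f' \<in> (J' \<rightarrow>\<^sub>E B') \<rightarrow> (I \<rightarrow>\<^sub>E A)"
    unfolding f'_def by (intro Pi_I funcset_mem[OF fA] down)
  ultimately have "generates_via J' B' f' I A K L"
    using fin im sub by (auto simp: generates_via_def J'_def B'_def)
  then show ?thesis unfolding generates_def by blast
qed

end

theory Submission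
  imports Defs
begin

text \<open>If no input is seen by all outputs, every input \<open>j\<close> is missed by some output \<open>c j\<close>.
  Start from an input \<open>a\<close> producing \<open>1\<^sup>n\<close>. Output \<open>0\<close> stays \<open>1\<close> when the inputs with
  \<open>c j = 0\<close> are changed at will, hence so does output \<open>1\<close> by monotonicity, which in turn does
  not see the inputs with \<open>c j = 1\<close>, and so on. The last output is then \<open>1\<close> for all inputs,
  so \<open>0\<^sup>n\<close> is not produced.\<close>

lemma nondecreasing_mono:
  assumes "u \<in> nondecreasing n" "i \<le> i'" "i' < n" "u i = 1"
  shows "u i' = 1"
  using assms by (auto simp: nondecreasing_def split: if_splits)

lemma input_windowD:
  assumes "finite J" "x \<in> J \<rightarrow>\<^sub>E B" "y \<in> J \<rightarrow>\<^sub>E B"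
    and "\<And>j. j \<in> input_window J B f i \<Longrightarrow> x j = y j"
  shows "f x i = f y i"
  by (rule determinesD[OF input_window(2)[OF assms(1)] assms(2,3)])
     (auto intro!: restrict_ext assms(4))

text \<open>Induction on \<open>k\<close>: the inputs \<open>j\<close> with
  \<open>c j \<le> k\<close> are free, those with \<open>c j > k\<close> are frozen at
  \<open>a\<close>. Each step frees one more class, so \<open>x\<close> must be arbitrary in the
  induction.\<close>

lemma last_output_eq_1:
  assumes fin: "finite J"
    and mono: "f ` (J \<rightarrow>\<^sub>E B) \<subseteq> nondecreasing n"
    and a: "a \<in> J \<rightarrow>\<^sub>E B" "f a 0 = 1"
    and c: "\<And>j. j \<in> J \<Longrightarrow> j \<notin> input_window J B f (c j)"
    and "k < n" "x \<in> J \<rightarrow>\<^sub>E B" "\<And>j. j \<in> J \<Longrightarrow> k < c j \<Longrightarrow> x j = a j"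
  shows "f x k = 1"
  using assms(6-8)
proof (induction k arbitrary: x)
  case 0
  have "x j = a j" if "j \<in> input_window J B f 0" for j
  proof -
    have "j \<in> J" using that input_window(1)[OF fin, of B f 0] by blast
    moreover from this have "c j \<noteq> 0" using c that by metis
    ultimately show ?thesis using "0.prems"(3) by blast
  qed
  then have "f x 0 = f a 0"
    by (rule input_windowD[OF fin "0.prems"(2) a(1)])
  with a(2) show ?case by simp
next
  case (Suc k)
  \<comment> \<open>\<open>z\<close> freezes the class \<open>c j = Suc k\<close> again, so the
    induction hypothesis applies to it. Output \<open>Suc k\<close> does not see that class and
    cannot tell \<open>z\<close> from \<open>x\<close>.\<close>
  define z where "z = (\<lambda>j. if j \<in> J \<and> c j = Suc k then a j else x j)"
  have z: "z \<in> J \<rightarrow>\<^sub>E B"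
    using Suc.prems(2) a(1) by (auto simp: z_def PiE_iff extensional_def)
  have "z j = a j" if "j \<in> J" "k < c j" for j
    using that Suc.prems(3) by (cases "c j = Suc k") (auto simp: z_def)
  then have "f z k = 1"
    using Suc.IH[OF _ z] Suc.prems(1) by simp
  then have "f z (Suc k) = 1"
    using nondecreasing_mono[of "f z" n k "Suc k"] mono z Suc.prems(1) by auto
  moreover have "f x (Suc k) = f z (Suc k)"
  proof (rule input_windowD[OF fin Suc.prems(2) z])
    fix j assume "j \<in> input_window J B f (Suc k)"
    then show "x j = z j" using c[of j] by (auto simp: z_def)
  qed
  ultimately show ?case by simp
qed

text \<open>A common input makes \<open>{..<n}\<close> a simplex of the communication complex;
  closure under subsets then leaves only the full complex.\<close>

lemma common_input:
  assumes "finite J" "f ` (J \<rightarrow>\<^sub>E B) = nondecreasing n" "n \<ge> 1"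
  shows "(\<Inter>i\<in>{..<n}. input_window J B f i) \<noteq> {}"
proof
  assume "(\<Inter>i\<in>{..<n}. input_window J B f i) = {}"
  then have "\<forall>j. \<exists>i. i < n \<and> j \<notin> input_window J B f i" by auto
  then obtain c where c: "\<And>j. c j < n \<and> j \<notin> input_window J B f (c j)" by metis
  have "(\<lambda>i\<in>{..<n}. if i < k then 0 else 1) \<in> f ` (J \<rightarrow>\<^sub>E B)" if "k \<le> n" for k
    using that assms(2) by (auto simp: nondecreasing_def)
  \<comment> \<open>The two extreme words: \<open>a\<close> produces all ones, \<open>b\<close> all
    zeros.\<close>
  from this[of 0] this[of n] obtain a b where
    a: "a \<in> J \<rightarrow>\<^sub>E B" "f a = (\<lambda>i\<in>{..<n}. if i < 0 then 0 else 1)" and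
    b: "b \<in> J \<rightarrow>\<^sub>E B" "f b = (\<lambda>i\<in>{..<n}. if i < n then 0 else 1)"
    by (auto simp del: not_less_zero)
  \<comment> \<open>Vacuous, since \<open>c j < n\<close>: at \<open>k = n - 1\<close> no input is
    frozen any more.\<close>
  have "b j = a j" if "n - 1 < c j" for j
    using that c[of j] by linarith
  then have "f b (n - 1) = 1"
    using last_output_eq_1[of J f B n a c "n - 1" b] assms a b(1) c by auto
  with b(2) assms(3) show False by simp
qed

text \<open>A single input holding the number of leading zeros suffices, as the full complex puts no
  constraint on the windows.\<close>

lemma generates_full: "generates {..<n} {0, 1} (Pow {..<n}) (nondecreasing n)"
proof (rule generates_viaI)
  let ?f = "\<lambda>x :: unit \<Rightarrow> nat. \<lambda>i\<in>{..<n}. if i < x () then 0 else 1 :: nat"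
  have "nondecreasing n \<subseteq> ?f ` ({()} \<rightarrow>\<^sub>E {..n})"
  proof
    fix u assume "u \<in> nondecreasing n"
    then obtain k where k: "k \<le> n" "u = (\<lambda>i\<in>{..<n}. if i < k then 0 else 1)"
      by (auto simp: nondecreasing_def)
    show "u \<in> ?f ` ({()} \<rightarrow>\<^sub>E {..n})"
    proof (rule image_eqI)
      show "u = ?f (\<lambda>_. k)" using k(2) by simp
      show "(\<lambda>_. k) \<in> {()} \<rightarrow>\<^sub>E {..n}" using k(1) by auto
    qed
  qed
  moreover have "?f ` ({()} \<rightarrow>\<^sub>E {..n}) \<subseteq> nondecreasing n"
  proof (rule image_subsetI)
    fix x assume "x \<in> {()} \<rightarrow>\<^sub>E {..n}"
    then have "x () \<le> n" by auto
    then show "?f x \<in> nondecreasing n" unfolding nondecreasing_def by blast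
  qed
  ultimately show "generates_via {()} {..n} ?f {..<n} {0, 1} (Pow {..<n}) (nondecreasing n)"
    by (auto simp: generates_via_def communication_complex_def)
qed

theorem proposition3p2:
  fixes n :: nat
  assumes "n \<ge> 1"
  shows "\<forall>K. (complex_over {..<n} K \<and> generates {..<n} {0, 1} K (nondecreasing n))
           \<longleftrightarrow> K = Pow {..<n}"
proof (intro allI iffI)
  fix K assume K: "complex_over {..<n} K \<and> generates {..<n} {0, 1} K (nondecreasing n)"
  then obtain J B :: "nat set" and f where
    "generates_via J B f {..<n} {0, 1} K (nondecreasing n)"
    by (auto simp: generates_def)
  then have fin: "finite J" and im: "f ` (J \<rightarrow>\<^sub>E B) = nondecreasing n"
    and sub: "communication_complex J B {..<n} f \<subseteq> K"
    by (auto simp: generates_via_def)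
  have "{..<n} \<in> communication_complex J B {..<n} f"
    using common_input[OF fin im assms] by (simp add: communication_complex_def)
  with sub have "{..<n} \<in> K" by blast
  with K show "K = Pow {..<n}" by (auto simp: complex_over_def)
next
  fix K assume "K = Pow {..<n}"
  then show "complex_over {..<n} K \<and> generates {..<n} {0, 1} K (nondecreasing n)"
    using generates_full by (auto simp: complex_over_def)
qed

end
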